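(* Let $f:[0,1]\times\mathbb{R}^2\to\mathbb{R}$ be continuous and consider the periodic boundary value problem $$-x''=f(t,x,x')\quad (t\in[0,1]),\qquad x(0)=x(1),\quad x'(0)=x'(1). \qquad (P)$$ Suppose that: (i) $(P)$ has a lower solution $\alpha$ and an upper solution $\beta$ with $\alpha(t)\le\beta(t)$ for $t\in[0,1]$, $\alpha'(0)-\alpha'(1)\ge0$ and $\beta'(1)-\beta'(0)\ge0$; and there are constants $\mu>0$ and $\ell>0$ such that $$|f(t,x_1,y_1)-f(t,x_2,y_2)|\le\ell|x_1-x_2|+\ell|y_1-y_2|$$ whenever $(t,x_i,y_i)\in G_{\alpha,\mu}$ for $i=1,2$, or $(t,x_i,y_i)\in G_{\beta,\mu}$ for $i=1,2$. (ii) There are constants $L>0$, $K>0$, a constant $c<1$, and a function $c(t)\in C[0,1]$ with $c(t)(\beta(t)-\alpha(t))\le c$ for all $t\in[0,1]$, such that $$f(t,x,\alpha'(t))-f(t,x,\alpha'(t)+z)\le c(t)z^2+Lz+K,$$ $$f(t,x,\beta'(t)-z)-f(t,x,\beta'(t))\le c(t)z^2+Lz+K$$ whenever $t\in[0,1]$, $\alpha(t)\le x\le\beta(t)$ and $z\ge0$. Then problem $(P)$ has a solution $x(t)$ satisfying $\alpha(t)\le x(t)\le\beta(t)$ for all $t\in[0,1]$.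
   Context: A function $\alpha\in C^2[0,1]$ is a lower solution of $(P)$ if $-\alpha''(t)\le f(t,\alpha(t),\alpha'(t))$ for $t\in[0,1]$ and $\alpha(0)=\alpha(1)$. A function $\beta\in C^2[0,1]$ is an upper solution of $(P)$ if $-\beta''(t)\ge f(t,\beta(t),\beta'(t))$ for $t\in[0,1]$ and $\beta(0)=\beta(1)$. For $\gamma\in C^1[0,1]$ and $\mu>0$, $$G_{\gamma,\mu}=\{(t,x,y)\in\mathbb{R}^3:\ t\in[0,1],\ \gamma(t)-\mu\le x\le\gamma(t)+\mu,\ \gamma'(t)-\mu\le y\le\gamma'(t)+\mu\}.$$ *)

theory Defs
  imports "HOL-Analysis.Analysis"
begin

(* Derivative relative to [0,1], hence one-sided at 0 and 1: functions on [0,1] are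
   represented by total functions, whose values outside [0,1] must not matter.
   The value is meaningful only where the derivative exists. *)
definition D01 :: "(real \<Rightarrow> real) \<Rightarrow> real \<Rightarrow> real" where
  "D01 x t = vector_derivative x (at t within {0..1})"

lemma D01_eq:
  assumes "t \<in> {0..1}" "(x has_real_derivative d) (at t within {0..1})"
  shows "D01 x t = d"
  using assms vector_derivative_within_closed_interval[of 0 1 t x d]
  by (simp add: D01_def has_real_derivative_iff_has_vector_derivative)

definition C1_01 :: "(real \<Rightarrow> real) \<Rightarrow> bool" where
  "C1_01 x \<longleftrightarrow> x differentiable_on {0..1} \<and> continuous_on {0..1} (D01 x)"

definition C2_01 :: "(real \<Rightarrow> real) \<Rightarrow> bool" where
  "C2_01 x \<longleftrightarrow> C1_01 x \<and> C1_01 (D01 x)"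

lemma C1_01_has_derivative:
  assumes "C1_01 x" "t \<in> {0..1}"
  shows "(x has_real_derivative D01 x t) (at t within {0..1})"
  using assms unfolding C1_01_def D01_def differentiable_on_def
  by (simp add: has_real_derivative_iff_has_vector_derivative vector_derivative_works)

definition solution :: "(real \<times> real \<times> real \<Rightarrow> real) \<Rightarrow> (real \<Rightarrow> real) \<Rightarrow> bool" where
  "solution f x \<longleftrightarrow> C2_01 x \<and>
     (\<forall>t\<in>{0..1}. - D01 (D01 x) t = f (t, x t, D01 x t)) \<and>
     x 0 = x 1 \<and> D01 x 0 = D01 x 1"

(* Lower and upper solutions impose no condition on the derivatives at 0 and 1. *)
definition lower_solution :: "(real \<times> real \<times> real \<Rightarrow> real) \<Rightarrow> (real \<Rightarrow> real) \<Rightarrow> bool" where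
  "lower_solution f \<alpha> \<longleftrightarrow> C2_01 \<alpha> \<and>
     (\<forall>t\<in>{0..1}. - D01 (D01 \<alpha>) t \<le> f (t, \<alpha> t, D01 \<alpha> t)) \<and>
     \<alpha> 0 = \<alpha> 1"

definition upper_solution :: "(real \<times> real \<times> real \<Rightarrow> real) \<Rightarrow> (real \<Rightarrow> real) \<Rightarrow> bool" where
  "upper_solution f \<beta> \<longleftrightarrow> C2_01 \<beta> \<and>
     (\<forall>t\<in>{0..1}. - D01 (D01 \<beta>) t \<ge> f (t, \<beta> t, D01 \<beta> t)) \<and>
     \<beta> 0 = \<beta> 1"

definition G :: "(real \<Rightarrow> real) \<Rightarrow> real \<Rightarrow> (real \<times> real \<times> real) set" where
  "G \<gamma> \<mu> = {(t, x, y). t \<in> {0..1} \<and> \<gamma> t - \<mu> \<le> x \<and> x \<le> \<gamma> t + \<mu> \<and>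
                          D01 \<gamma> t - \<mu> \<le> y \<and> y \<le> D01 \<gamma> t + \<mu>}"

end

theory Submission
  imports Defs "HOL-Complex_Analysis.Great_Picard"
begin

text \<open>
  Truncate \<open>x\<close> to \<open>[\<alpha>(t), \<beta>(t)]\<close> and \<open>x'\<close> to \<open>[-R, R]\<close>, and add a penalty, to get a problem
  \<open>x'' = x - g(t, x, x')\<close> with \<open>g\<close> bounded. In the variables \<open>u = x' + x\<close>, \<open>w = x' - x\<close> the linear part
  becomes the saddle \<open>u' = u\<close>, \<open>w' = -w\<close>, so a two-dimensional Brouwer argument yields periodic orbits
  of Euler's scheme inside a fixed square, and Arzela--Ascoli extracts a periodic solution. The maximum
  principle puts it between \<open>\<alpha>\<close> and \<open>\<beta>\<close>.

  For the derivative bound put \<open>z = x' - \<alpha>'\<close> and \<open>C = sup |c|\<close>. The growth condition gives the Riccati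
  inequality \<open>z' \<le> (C z + D)(1 + z)\<close> where \<open>z \<ge> 0\<close>, with \<open>D\<close> independent of \<open>R\<close>, so there
  \<open>(1 + z) exp(-C (x - \<alpha>) - D t)\<close> decreases. Since \<open>z\<close> vanishes somewhere by Rolle's theorem and
  \<open>z(0) \<le> z(1)\<close>, this bounds \<open>x'\<close> from above on the whole period; \<open>\<beta>' - x'\<close> bounds it from below
  in the same way. For \<open>R\<close> large enough the truncation is therefore inactive.
\<close>

section \<open>Derivatives on the unit interval\<close>

lemma derivative_01_at:
  assumes "\<And>t. t \<in> {0..1} \<Longrightarrow> (x has_real_derivative x' t) (at t within {0..1})"
  shows "\<And>t. 0 < t \<Longrightarrow> t < 1 \<Longrightarrow> (x has_real_derivative x' t) (at t)" "continuous_on {0..1} x"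
proof -
  show "(x has_real_derivative x' t) (at t)" if "0 < t" "t < 1" for t
    using assms[of t] that at_within_interior[of t "{0..1::real}"] by simp
  show "continuous_on {0..1} x"
    by (rule DERIV_continuous_on) (rule assms)
qed

lemma C1_01I:
  assumes "\<And>t. t \<in> {0..1} \<Longrightarrow> (x has_real_derivative x' t) (at t within {0..1})"
    and "continuous_on {0..1} x'"
  shows "C1_01 x"
proof -
  have "continuous_on {0..1} (D01 x)"
    using assms(2) by (rule continuous_on_eq) (use assms(1) D01_eq in metis)
  then show ?thesis
    using assms(1) unfolding C1_01_def differentiable_on_def real_differentiable_def by blast
qed

lemma C2_01I:
  assumes x: "\<And>t. t \<in> {0..1} \<Longrightarrow> (x has_real_derivative x' t) (at t within {0..1})"
    and x': "\<And>t. t \<in> {0..1} \<Longrightarrow> (x' has_real_derivative x'' t) (at t within {0..1})"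
    and cont: "continuous_on {0..1} x''"
  shows "C2_01 x" "\<And>t. t \<in> {0..1} \<Longrightarrow> D01 x t = x' t" "\<And>t. t \<in> {0..1} \<Longrightarrow> D01 (D01 x) t = x'' t"
proof -
  show eq: "D01 x t = x' t" if "t \<in> {0..1}" for t
    using D01_eq[OF that x[OF that]] .
  \<comment> \<open>\<open>D01 x\<close> is known to equal \<open>x'\<close> only on the unit
    interval. The derivative relative to that interval sees no other values, so the transfer works
    at the endpoints too.\<close>
  have d: "(D01 x has_real_derivative x'' t) (at t within {0..1})" if "t \<in> {0..1}" for t
    using x'[OF that] unfolding has_field_derivative_def
    by (rule has_derivative_transform[OF that, rotated]) (rule eq)
  show "D01 (D01 x) t = x'' t" if "t \<in> {0..1}" for t
    using D01_eq[OF that d[OF that]] .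
  show "C2_01 x"
    unfolding C2_01_def using C1_01I[OF x derivative_01_at(2)[OF x']] C1_01I[OF d cont] by simp
qed

lemma C2_01_derivatives:
  assumes "C2_01 x"
  shows "\<And>t. t \<in> {0..1} \<Longrightarrow> (x has_real_derivative D01 x t) (at t within {0..1})"
    and "\<And>t. t \<in> {0..1} \<Longrightarrow> (D01 x has_real_derivative D01 (D01 x) t) (at t within {0..1})"
    and "continuous_on {0..1} x" "continuous_on {0..1} (D01 x)" "continuous_on {0..1} (D01 (D01 x))"
proof -
  have C: "C1_01 x" "C1_01 (D01 x)" using assms by (auto simp: C2_01_def)
  show "(x has_real_derivative D01 x t) (at t within {0..1})"
    and "(D01 x has_real_derivative D01 (D01 x) t) (at t within {0..1})" if "t \<in> {0..1}" for t
    using C1_01_has_derivative C that by auto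
  then show "continuous_on {0..1} x" using derivative_01_at(2) by blast
  show "continuous_on {0..1} (D01 x)" "continuous_on {0..1} (D01 (D01 x))"
    using C by (auto simp: C1_01_def)
qed

section \<open>Limits of Euler polygons\<close>

text \<open>For \<open>t >= 0\<close> this is the length of the part of [0, t] inside the
  \<open>k\<close>-th of the \<open>Suc n\<close> equal pieces of [0, 1]. With these weights a
  broken line is a plain sum over its slopes, with no case distinction on the piece containing
  \<open>t\<close>.\<close>

definition ramp :: "nat \<Rightarrow> nat \<Rightarrow> real \<Rightarrow> real" where
  "ramp n k t = max 0 (min (t - real k / Suc n) (1 / Suc n))"

lemma ramp_mono: "s \<le> t \<Longrightarrow> ramp n k s \<le> ramp n k t"
  by (auto simp: ramp_def)

lemma ramp_eq:
  assumes "s \<le> t" "t \<le> real k / Suc n \<or> real (Suc k) / Suc n \<le> s"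
  shows "ramp n k s = ramp n k t"
  using assms by (auto simp: ramp_def add_divide_distrib)

lemma sum_ramp_min: "0 \<le> t \<Longrightarrow> (\<Sum>k<m. ramp n k t) = min t (real m / Suc n)"
proof (induction m)
  case (Suc m)
  have "real (Suc m) / Suc n = real m / Suc n + 1 / Suc n"
    by (simp add: add_divide_distrib)
  moreover have "0 < 1 / real (Suc n)" by simp
  moreover have "(\<Sum>k<Suc m. ramp n k t) = min t (real m / Suc n) + ramp n m t"
    using Suc by simp
  ultimately show ?case
    unfolding ramp_def by linarith
qed (simp)

lemma sum_ramp: "t \<in> {0..1} \<Longrightarrow> (\<Sum>k<Suc n. ramp n k t) = t"
  using sum_ramp_min[of t n "Suc n"] by (simp del: sum.lessThan_Suc)

lemma ramp_node: "ramp n k (real j / Suc n) = (if k < j then 1 / Suc n else 0)"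
proof (cases "k < j")
  case True
  then have "real (Suc k) / Suc n \<le> real j / Suc n"
    by (intro divide_right_mono) auto
  moreover have "real (Suc k) / Suc n = real k / Suc n + 1 / Suc n"
    by (simp add: add_divide_distrib)
  moreover have "0 < 1 / real (Suc n)" by simp
  ultimately have "ramp n k (real j / Suc n) = 1 / Suc n"
    unfolding ramp_def by linarith
  with True show ?thesis by simp
next
  case False
  then have "real j / Suc n \<le> real k / Suc n"
    by (intro divide_right_mono) auto
  with False show ?thesis by (auto simp: ramp_def)
qed

text \<open>The ramps add up to the identity on \<open>[0, 1]\<close>, so this is the broken line from \<open>z0\<close> with
  slope \<open>V k\<close> on the \<open>k\<close>-th of \<open>Suc n\<close> equal pieces.\<close>
definition polygon :: "nat \<Rightarrow> 'a \<Rightarrow> (nat \<Rightarrow> 'a) \<Rightarrow> real \<Rightarrow> 'a::real_normed_vector" where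
  "polygon n z0 V t = z0 + (\<Sum>k<Suc n. ramp n k t *\<^sub>R V k)"

lemma polygon_node:
  assumes "\<And>k. k \<le> n \<Longrightarrow> z (Suc k) = z k + (1 / Suc n) *\<^sub>R V k" and "j \<le> Suc n"
  shows "polygon n (z 0) V (real j / Suc n) = z j"
proof -
  have "(\<Sum>k<Suc n. ramp n k (real j / Suc n) *\<^sub>R V k)
      = (\<Sum>k\<in>{..<Suc n} \<inter> {k. k < j}. (1 / Suc n) *\<^sub>R V k)"
    unfolding ramp_node by (simp add: sum.inter_restrict if_distribR if_distrib cong: if_cong)
  also have "{..<Suc n} \<inter> {k. k < j} = {..<j}"
    using assms(2) by auto
  also have "(\<Sum>k<j. (1 / Suc n) *\<^sub>R V k) = z j - z 0"
    using assms(2)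
  proof (induction j)
    case (Suc j)
    then show ?case using assms(1)[of j] by simp
  qed simp
  finally show ?thesis by (simp add: polygon_def)
qed

text \<open>The increment over [s, t] is a combination of the slopes; its weights are the ramp
  increments, which are nonnegative, add up to \<open>t - s\<close>, and vanish on pieces not
  meeting [s, t]. Taking \<open>v = 0\<close> gives equicontinuity; taking \<open>v\<close> as the
  field at a point gives the derivative of a limit.\<close>

lemma polygon_deviation:
  assumes st: "s \<in> {0..1}" "t \<in> {0..1}" "s \<le> t"
    and V: "\<And>k. k \<le> n \<Longrightarrow> real k / Suc n \<le> t \<Longrightarrow> s \<le> real (Suc k) / Suc n \<Longrightarrow> norm (V k - v) \<le> e"
  shows "norm (polygon n z0 V t - polygon n z0 V s - (t - s) *\<^sub>R v) \<le> e * (t - s)"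
proof -
  let ?d = "\<lambda>k. ramp n k t - ramp n k s"
  have sd: "(\<Sum>k<Suc n. ?d k) = t - s"
    using st by (simp only: sum_subtractf sum_ramp)
  have "polygon n z0 V t - polygon n z0 V s - (t - s) *\<^sub>R v = (\<Sum>k<Suc n. ?d k *\<^sub>R (V k - v))"
    unfolding sd[symmetric] polygon_def
    by (simp add: sum_subtractf scaleR_sum_left scaleR_diff_left scaleR_diff_right algebra_simps sum.distrib
        del: sum.lessThan_Suc)
  also have "norm \<dots> \<le> (\<Sum>k<Suc n. ?d k * e)"
  proof (rule sum_norm_le)
    fix k assume "k \<in> {..<Suc n}"
    then have "k \<le> n" by simp
    show "norm (?d k *\<^sub>R (V k - v)) \<le> ?d k * e"
    proof (cases "real k / Suc n \<le> t \<and> s \<le> real (Suc k) / Suc n")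
      case True
      then show ?thesis
        using V[OF \<open>k \<le> n\<close>] ramp_mono[OF st(3), of n k] by (auto intro!: mult_left_mono)
    next
      case False
      then have "ramp n k s = ramp n k t" by (intro ramp_eq[OF st(3)]) linarith
      then show ?thesis by simp
    qed
  qed
  also have "\<dots> = e * (t - s)"
    unfolding sum_distrib_right[symmetric] sd by simp
  finally show ?thesis .
qed

text \<open>Peano's argument for prescribed discrete orbits. The orbits stay in a compact set, so
  the slopes share a bound \<open>M\<close>, the polygons share a Lipschitz constant, and
  Arzela-Ascoli applies. The derivative of the limit is read off from
  \<open>polygon_deviation\<close> directly, without an integral equation; periodicity survives
  pointwise limits.\<close>

lemma euler_polygons_limit:
  fixes F :: "real \<times> 'a::euclidean_space \<Rightarrow> 'a" and Z :: "nat \<Rightarrow> nat \<Rightarrow> 'a"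
  assumes F: "continuous_on ({0..1} \<times> UNIV) F"
    and step: "\<And>n k. k \<le> n \<Longrightarrow> Z n (Suc k) = Z n k + (1 / Suc n) *\<^sub>R F (real k / Suc n, Z n k)"
    and bound: "\<And>n k. k \<le> Suc n \<Longrightarrow> norm (Z n k) \<le> B"
    and periodic: "\<And>n. Z n (Suc n) = Z n 0"
  obtains g where "g 0 = g 1"
    and "\<And>t. t \<in> {0..1} \<Longrightarrow> (g has_vector_derivative F (t, g t)) (at t within {0..1})"
proof -
  define V where "V n k = F (real k / Suc n, Z n k)" for n k
  define P where "P n = polygon n (Z n 0) (V n)" for n
  have node: "P n (real j / Suc n) = Z n j" if "j \<le> Suc n" for n j
    unfolding P_def by (rule polygon_node) (use step that in \<open>auto simp: V_def\<close>)
  have node01: "real k / Suc n \<in> {0..1}" if "k \<le> Suc n" for k n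
    using that by auto
  have "compact (F ` ({0..1} \<times> cball 0 B))"
    by (intro compact_continuous_image continuous_on_subset[OF F] compact_Times) auto
  then obtain M where M: "\<And>y. y \<in> F ` ({0..1} \<times> cball 0 B) \<Longrightarrow> norm y \<le> M" "M > 0"
    using compact_imp_bounded bounded_pos by metis
  have VM: "norm (V n k) \<le> M" if "k \<le> n" for n k
    unfolding V_def using that node01[of k n] bound[of k n] by (intro M imageI) auto
  have lip1: "norm (P n t - P n s) \<le> M * (t - s)" if "s \<in> {0..1}" "t \<in> {0..1}" "s \<le> t" for n s t
    using polygon_deviation[OF that, of n "V n" 0 M "Z n 0"] VM by (simp add: P_def)
  have lip: "norm (P n t - P n s) \<le> M * \<bar>t - s\<bar>" if "s \<in> {0..1}" "t \<in> {0..1}" for n s t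
    using lip1[of s t n] lip1[of t s n] that by (cases "s \<le> t") (auto simp: norm_minus_commute)
  have "norm (P n t) \<le> B + M" if "t \<in> {0..1}" for n t
  proof -
    have "norm (P n t - P n 0) \<le> M * \<bar>t - 0\<bar>" by (rule lip) (use that in auto)
    also have "\<dots> \<le> M * 1" using that M by (intro mult_left_mono) auto
    finally have "norm (P n t) \<le> norm (P n 0) + M" by norm
    moreover have "norm (P n 0) \<le> B" using node[of 0 n] bound[of 0 n] by simp
    ultimately show ?thesis by simp
  qed
  moreover have "\<exists>d>0. \<forall>n y. y \<in> {0..1} \<and> norm (x - y) < d \<longrightarrow> norm (P n x - P n y) < e"
    if "x \<in> {0..1}" "0 < e" for x e
  proof (intro exI[of _ "e / M"] conjI allI impI)
    fix n y assume y: "y \<in> {0..1::real} \<and> norm (x - y) < e / M"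
    have "norm (P n x - P n y) \<le> M * \<bar>x - y\<bar>" by (rule lip) (use that y in auto)
    also have "\<dots> < e" using y M by (simp add: field_simps)
    finally show "norm (P n x - P n y) < e" .
  qed (use that M in auto)
  ultimately obtain g r where g: "continuous_on {0..1} g" and r: "strict_mono (r :: nat \<Rightarrow> nat)"
    and lim: "\<And>e. 0 < e \<Longrightarrow> \<exists>N. \<forall>n x. n \<ge> N \<and> x \<in> {0..1} \<longrightarrow> norm (P (r n) x - g x) < e"
    using Arzela_Ascoli[of "{0..1::real}" P "B + M"] by (metis compact_Icc)
  have ptw: "(\<lambda>n. P (r n) x) \<longlonglongrightarrow> g x" if "x \<in> {0..1}" for x
    unfolding LIMSEQ_iff using lim that by blast
  show thesis
  proof
    have "P n 0 = P n 1" for n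
      using node[of 0 n] node[of "Suc n" n] periodic[of n] by simp
    with ptw[of 0] ptw[of 1] show "g 0 = g 1"
      by (auto intro: LIMSEQ_unique)
  next
    fix t0 :: real assume t0: "t0 \<in> {0..1}"
    let ?v = "F (t0, g t0)"
    have "\<exists>d>0. \<forall>t\<in>{0..1}. norm (t - t0) < d \<longrightarrow> norm (g t - g t0 - (t - t0) *\<^sub>R ?v) \<le> e * norm (t - t0)"
      if "e > 0" for e
    proof -
      obtain d where d: "d > 0" and Fd: "\<And>p. p \<in> {0..1} \<times> UNIV \<Longrightarrow> dist p (t0, g t0) < d \<Longrightarrow> dist (F p) ?v < e"
        using F t0 \<open>e > 0\<close> unfolding continuous_on_iff by (metis SigmaI UNIV_I)
      obtain d1 where d1: "d1 > 0" and gd: "\<And>s. s \<in> {0..1} \<Longrightarrow> dist s t0 < d1 \<Longrightarrow> dist (g s) (g t0) < d / 4"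
        using g t0 d unfolding continuous_on_iff by (metis zero_less_divide_iff zero_less_numeral)
      \<comment> \<open>A piece meeting [s, t] may start up to one step length before
        \<open>s\<close>. Once steps are shorter than \<open>d2\<close>, its left node is still
        within \<open>2 * d2\<close> of \<open>t0\<close>, hence the halving. The budget
        \<open>d\<close> is split into \<open>d / 2\<close> for time and twice \<open>d / 4\<close>
        for the state: from polygon to limit, and from there to \<open>g t0\<close>.\<close>
      define d2 where "d2 = min d1 (d / 2) / 2"
      have d2: "d2 > 0" "2 * d2 \<le> d1" "2 * d2 \<le> d / 2" using d d1 by (auto simp: d2_def)
      obtain N1 where N1: "\<And>n x. n \<ge> N1 \<Longrightarrow> x \<in> {0..1} \<Longrightarrow> norm (P (r n) x - g x) < d / 4"
        using lim[of "d / 4"] d by auto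
      obtain N2 where N2: "1 / real (Suc N2) < d2"
        using d2(1) nat_approx_posE by blast
      have dev: "norm (P (r n) t - P (r n) s - (t - s) *\<^sub>R ?v) \<le> e * (t - s)"
        if n: "n \<ge> max N1 N2" and st: "s \<in> {0..1}" "t \<in> {0..1}" "s \<le> t" "\<bar>s - t0\<bar> < d2" "\<bar>t - t0\<bar> < d2" for n s t
        unfolding P_def
      proof (rule polygon_deviation[OF st(1-3)])
        fix k assume k: "k \<le> r n" "real k / Suc (r n) \<le> t" "s \<le> real (Suc k) / Suc (r n)"
        let ?\<tau> = "real k / Suc (r n)"
        have "N2 \<le> r n" using n seq_suble[OF r, of n] by simp
        then have "1 / real (Suc (r n)) \<le> 1 / real (Suc N2)" by (simp add: frac_le)
        then have "\<bar>?\<tau> - t0\<bar> < 2 * d2"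
          using k(2,3) st N2 by (simp add: add_divide_distrib abs_less_iff)
        moreover have \<tau>: "?\<tau> \<in> {0..1}" using node01 k by simp
        ultimately have "dist (g ?\<tau>) (g t0) < d / 4" "dist ?\<tau> t0 < d / 2"
          using gd[of ?\<tau>] d2 by (auto simp: dist_real_def)
        moreover have "dist (Z (r n) k) (g ?\<tau>) < d / 4"
          using N1[of n ?\<tau>] n \<tau> node[of k "r n"] k by (simp add: dist_norm)
        ultimately have "dist ?\<tau> t0 < d / 2" "dist (Z (r n) k) (g t0) < d / 2"
          using dist_triangle[of "Z (r n) k" "g t0" "g ?\<tau>"] by auto
        then have "dist (?\<tau>, Z (r n) k) (t0, g t0) < d"
          unfolding dist_Pair_Pair
          by (intro le_less_trans[OF sqrt_sum_squares_le_sum]) auto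
        then show "norm (V (r n) k - ?v) \<le> e"
          using Fd[of "(?\<tau>, Z (r n) k)"] \<tau> by (auto simp: V_def dist_norm intro: less_imp_le)
      qed
      have lim_dev: "norm (g t - g s - (t - s) *\<^sub>R ?v) \<le> e * (t - s)"
        if st: "s \<in> {0..1}" "t \<in> {0..1}" "s \<le> t" "\<bar>s - t0\<bar> < d2" "\<bar>t - t0\<bar> < d2" for s t
      proof (rule tendsto_upperbound)
        show "(\<lambda>n. norm (P (r n) t - P (r n) s - (t - s) *\<^sub>R ?v)) \<longlonglongrightarrow> norm (g t - g s - (t - s) *\<^sub>R ?v)"
          by (intro tendsto_intros ptw st)
        show "\<forall>\<^sub>F n in sequentially. norm (P (r n) t - P (r n) s - (t - s) *\<^sub>R ?v) \<le> e * (t - s)"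
          using dev[OF _ that] unfolding eventually_sequentially by blast
      qed simp
      show ?thesis
      proof (intro exI[of _ d2] conjI ballI impI)
        fix t :: real assume t: "t \<in> {0..1}" "norm (t - t0) < d2"
        show "norm (g t - g t0 - (t - t0) *\<^sub>R ?v) \<le> e * norm (t - t0)"
        proof (cases "t0 \<le> t")
          case True
          then show ?thesis using lim_dev[of t0 t] t t0 d2 by simp
        next
          case False
          have "g t0 - g t - (t0 - t) *\<^sub>R ?v = - (g t - g t0 - (t - t0) *\<^sub>R ?v)"
            by (simp add: algebra_simps)
          then show ?thesis using lim_dev[of t t0] t t0 d2 False
            by (metis abs_minus_commute abs_of_nonneg diff_ge_0_iff_ge diff_self abs_zero linear norm_minus_cancel real_norm_def)
        qed
      qed (use d2 in auto)
    qed
    then show "(g has_vector_derivative ?v) (at t0 within {0..1})"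
      unfolding has_vector_derivative_def has_derivative_within_alt
      by (auto intro: bounded_linear_scaleR_left)
  qed
qed

section \<open>Periodic solutions for a bounded nonlinearity\<close>

primrec euler :: "(real \<times> 'a \<Rightarrow> 'a) \<Rightarrow> nat \<Rightarrow> 'a \<Rightarrow> nat \<Rightarrow> 'a::real_normed_vector" where
  "euler F n z 0 = z"
| "euler F n z (Suc k) = euler F n z k + (1 / Suc n) *\<^sub>R F (real k / Suc n, euler F n z k)"

lemma continuous_on_euler:
  assumes F: "continuous_on ({0..1} \<times> UNIV) F" and "k \<le> Suc n"
  shows "continuous_on UNIV (\<lambda>z. euler F n z k)"
  using assms(2)
proof (induction k)
  case (Suc k)
  have "continuous_on UNIV (\<lambda>z. F (real k / Suc n, euler F n z k))"
    by (rule continuous_on_compose2[OF F]) (use Suc in \<open>auto intro!: continuous_intros\<close>)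
  with Suc show ?case by (auto intro!: continuous_intros)
qed simp

text \<open>The field of \<open>x'' = x - h\<close> in the coordinates \<open>u = x' + x\<close>, \<open>w = x' - x\<close>.\<close>
definition saddle_field :: "(real \<times> real \<times> real \<Rightarrow> real) \<Rightarrow> real \<times> real \<times> real \<Rightarrow> real \<times> real" where
  "saddle_field h = (\<lambda>(t, u, w). (u - h (t, u, w), - w - h (t, u, w)))"

lemma continuous_on_saddle_field:
  assumes "continuous_on S h"
  shows "continuous_on S (saddle_field h)"
  unfolding saddle_field_def split_def by (intro continuous_intros) (simp_all add: assms)

lemma saddle_euler_step:
  fixes h z n k
  defines "hk \<equiv> h (real k / Suc n, euler (saddle_field h) n z k)"
  shows "fst (euler (saddle_field h) n z (Suc k))
      = fst (euler (saddle_field h) n z k) + (fst (euler (saddle_field h) n z k) - hk) / Suc n"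
    and "snd (euler (saddle_field h) n z (Suc k))
      = snd (euler (saddle_field h) n z k) - (snd (euler (saddle_field h) n z k) + hk) / Suc n"
  unfolding hk_def
  by (simp_all add: saddle_field_def split_def field_simps)

text \<open>In the contracting coordinate each step is a convex combination of the old value and
  \<open>- h\<close>, so the interval [-M, M] is preserved. In the expanding coordinate the orbit is
  pushed outwards beyond \<open>M\<close> and \<open>- M\<close>, so the Euler map need not preserve
  the square; reversing its displacement there keeps the fixed points and, after clipping, gives the
  self-map \<open>T\<close> to which Brouwer's theorem applies.\<close>

lemma periodic_euler_exists:
  assumes h: "continuous_on ({0..1} \<times> UNIV) h" and M: "\<And>p. p \<in> {0..1} \<times> UNIV \<Longrightarrow> \<bar>h p\<bar> \<le> M"
  obtains z where "euler (saddle_field h) n z (Suc n) = z"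
    and "\<And>k. k \<le> Suc n \<Longrightarrow> norm (euler (saddle_field h) n z k) \<le> 2 * M"
proof -
  let ?E = "euler (saddle_field h) n"
  have hM: "\<bar>h (real k / Suc n, z)\<bar> \<le> M" if "k \<le> n" for k z
    by (rule M) (use that in auto)
  have M0: "0 \<le> M" using hM[of 0] by fastforce
  have snd_bound: "\<bar>snd (?E z k)\<bar> \<le> M" if "\<bar>snd z\<bar> \<le> M" "k \<le> Suc n" for z k
    using that(2)
  proof (induction k)
    case (Suc k)
    let ?w = "snd (?E z k)" and ?\<eta> = "h (real k / Suc n, ?E z k)"
    have "snd (?E z (Suc k)) = (1 - 1 / Suc n) * ?w + (1 / Suc n) * (- ?\<eta>)"
      unfolding saddle_euler_step by (simp add: left_diff_distrib add_divide_distrib)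
    moreover have "\<bar>\<dots>\<bar> \<le> (1 - 1 / Suc n) * M + (1 / Suc n) * M"
      using Suc hM[of k "?E z k"]
      by (intro order_trans[OF abs_triangle_ineq] add_mono) (auto simp: abs_mult intro!: mult_mono divide_right_mono)
    ultimately show ?case by (simp add: algebra_simps)
  qed (use that in simp)
  have grow: "fst (?E z k) \<le> fst (?E z j)" if "M \<le> fst (?E z k)" "k \<le> j" "j \<le> Suc n" for z k j
    using that(2,3)
  proof (induction j rule: dec_induct)
    case (step j)
    then have "0 \<le> fst (?E z j) - h (real j / Suc n, ?E z j)"
      using hM[of j "?E z j"] that(1) by (simp add: abs_le_iff)
    then have "fst (?E z j) \<le> fst (?E z (Suc j))"
      unfolding saddle_euler_step by simp
    with step show ?case by simp
  qed simp
  have shrink: "fst (?E z j) \<le> fst (?E z k)" if "fst (?E z k) \<le> - M" "k \<le> j" "j \<le> Suc n" for z k j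
    using that(2,3)
  proof (induction j rule: dec_induct)
    case (step j)
    then have "fst (?E z j) - h (real j / Suc n, ?E z j) \<le> 0"
      using hM[of j "?E z j"] that(1) by (simp add: abs_le_iff)
    then have "fst (?E z (Suc j)) \<le> fst (?E z j)"
      unfolding saddle_euler_step by (simp add: divide_nonpos_pos)
    with step show ?case by simp
  qed simp
  \<comment> \<open>Since \<open>fst\<close> cannot decrease from \<open>M\<close> nor increase from \<open>-M\<close>, the clipping in \<open>T\<close> is
    inactive at a fixed point, which is therefore a fixed point of the Euler map.\<close>
  define T where "T z = (max (- M) (min M (2 * fst z - fst (?E z (Suc n)))), snd (?E z (Suc n)))" for z
  let ?Q = "{-M..M} \<times> {-M..M}"
  have contE: "continuous_on ?Q (\<lambda>z. ?E z (Suc n))"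
    by (rule continuous_on_subset[OF continuous_on_euler]) (auto intro!: continuous_on_saddle_field h)
  obtain z where z: "z \<in> ?Q" "T z = z"
  proof (rule brouwer[of ?Q T])
    show "continuous_on ?Q T"
      unfolding T_def using contE by (intro continuous_intros)
    show "T \<in> ?Q \<rightarrow> ?Q"
    proof
      fix z assume "z \<in> ?Q"
      then have "\<bar>snd (?E z (Suc n))\<bar> \<le> M" by (intro snd_bound) auto
      then show "T z \<in> ?Q" using M0 by (auto simp: T_def abs_le_iff)
    qed
  qed (use M0 in \<open>auto intro!: compact_Times convex_Times\<close>)
  have fstT: "max (- M) (min M (2 * fst z - fst (?E z (Suc n)))) = fst z"
    and sndT: "snd (?E z (Suc n)) = snd z"
    using z(2) unfolding T_def by (metis fst_conv, metis snd_conv)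
  have zb: "\<bar>fst z\<bar> \<le> M" "\<bar>snd z\<bar> \<le> M" using z(1) by (auto simp: mem_Times_iff)
  have fstE: "fst (?E z (Suc n)) = fst z"
    using fstT grow[of z 0 "Suc n"] shrink[of z 0 "Suc n"] zb
    by (auto simp: max_def min_def simp del: euler.simps(2) split: if_splits)
  \<comment> \<open>An excursion above \<open>M\<close> or below \<open>- M\<close> could never be
    undone before the last step, but the orbit returns to \<open>fst z\<close>.\<close>
  have "\<bar>fst (?E z k)\<bar> \<le> M" if "k \<le> Suc n" for k
    using grow[of z k "Suc n"] shrink[of z k "Suc n"] that zb fstE by linarith
  then have "norm (?E z k) \<le> 2 * M" if "k \<le> Suc n" for k
    using that snd_bound[OF zb(2) that] norm_Pair_le[of "fst (?E z k)" "snd (?E z k)"] by fastforce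
  moreover have "?E z (Suc n) = z" using fstE sndT by (metis prod.collapse)
  ultimately show thesis by (rule that[rotated])
qed

text \<open>The orbit bound from \<open>periodic_euler_exists\<close> does not depend on
  \<open>n\<close>, as the passage to the limit requires. Half the difference and half the sum of
  \<open>u\<close> and \<open>w\<close> give back \<open>x\<close> and \<open>x'\<close>.\<close>

lemma bounded_periodic_bvp:
  fixes g :: "real \<times> real \<times> real \<Rightarrow> real"
  assumes g: "continuous_on ({0..1} \<times> UNIV) g" and M: "\<And>p. p \<in> {0..1} \<times> UNIV \<Longrightarrow> \<bar>g p\<bar> \<le> M"
  obtains x y where "x 0 = x 1" "y 0 = y 1"
    and "\<And>t. t \<in> {0..1} \<Longrightarrow> (x has_real_derivative y t) (at t within {0..1})"
    and "\<And>t. t \<in> {0..1} \<Longrightarrow> (y has_real_derivative x t - g (t, x t, y t)) (at t within {0..1})"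
proof -
  define h where "h = (\<lambda>(t, u, w). g (t, (u - w) / 2, (u + w) / 2))"
  have h: "continuous_on ({0..1} \<times> UNIV) h"
    unfolding h_def split_def
    by (rule continuous_on_compose2[OF g]) (auto intro!: continuous_intros)
  have hM: "\<bar>h p\<bar> \<le> M" if "p \<in> {0..1} \<times> UNIV" for p
    using that M by (auto simp: h_def)
  let ?F = "saddle_field h"
  have "\<exists>z. euler ?F n z (Suc n) = z \<and> (\<forall>k\<le>Suc n. norm (euler ?F n z k) \<le> 2 * M)" for n
    using periodic_euler_exists[OF h hM] by metis
  then obtain z where z: "\<And>n. euler ?F n (z n) (Suc n) = z n"
    "\<And>n k. k \<le> Suc n \<Longrightarrow> norm (euler ?F n (z n) k) \<le> 2 * M"
    by metis
  obtain \<gamma> where \<gamma>: "\<gamma> 0 = \<gamma> 1"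
    and d\<gamma>: "\<And>t. t \<in> {0..1} \<Longrightarrow> (\<gamma> has_vector_derivative ?F (t, \<gamma> t)) (at t within {0..1})"
  proof (rule euler_polygons_limit[of ?F "\<lambda>n. euler ?F n (z n)"])
    show "continuous_on ({0..1} \<times> UNIV) ?F" by (rule continuous_on_saddle_field[OF h])
    show "euler ?F n (z n) (Suc n) = euler ?F n (z n) 0" for n
      using z(1)[of n] by simp
  qed (rule euler.simps(2) z(2) | assumption | blast intro: that)+
  define u w where "u t = fst (\<gamma> t)" and "w t = snd (\<gamma> t)" for t
  have u: "(u has_real_derivative u t - h (t, u t, w t)) (at t within {0..1})"
    and w: "(w has_real_derivative - w t - h (t, u t, w t)) (at t within {0..1})" if "t \<in> {0..1}" for t
    using bounded_linear.has_vector_derivative[OF bounded_linear_fst d\<gamma>[OF that]]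
      bounded_linear.has_vector_derivative[OF bounded_linear_snd d\<gamma>[OF that]]
    by (simp_all add: saddle_field_def split_def u_def[abs_def] w_def[abs_def] has_real_derivative_iff_has_vector_derivative)
  show thesis
  proof (rule that[of "\<lambda>t. (u t - w t) / 2" "\<lambda>t. (u t + w t) / 2"])
    show "((\<lambda>t. (u t - w t) / 2) has_real_derivative (u t + w t) / 2) (at t within {0..1})" if "t \<in> {0..1}" for t
      by (rule derivative_eq_intros u w that refl | simp add: field_simps)+
    show "((\<lambda>t. (u t + w t) / 2) has_real_derivative
        (u t - w t) / 2 - g (t, (u t - w t) / 2, (u t + w t) / 2)) (at t within {0..1})" if "t \<in> {0..1}" for t
      by (rule derivative_eq_intros u w that refl | simp add: h_def field_simps)+
  qed (simp_all add: u_def w_def \<gamma>)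
qed

section \<open>Maximum principle and derivative bound\<close>

text \<open>At a positive maximum \<open>v'\<close> vanishes. If it is attained at the endpoints,
  the one-sided signs \<open>v' 0 <= 0 <= v' 1\<close> together with \<open>v' 1 <= v' 0\<close>
  force this as well. Then \<open>v'' > 0\<close> makes \<open>v\<close> increase to the right of
  the maximum, which is impossible.\<close>

lemma periodic_max_principle:
  fixes v v' v'' :: "real \<Rightarrow> real"
  assumes v: "\<And>t. t \<in> {0..1} \<Longrightarrow> (v has_real_derivative v' t) (at t within {0..1})"
    and v': "\<And>t. t \<in> {0..1} \<Longrightarrow> (v' has_real_derivative v'' t) (at t within {0..1})"
    and bc: "v 0 = v 1" "v' 1 \<le> v' 0"
    and pos: "\<And>t. t \<in> {0..1} \<Longrightarrow> 0 < v t \<Longrightarrow> v' t = 0 \<Longrightarrow> 0 < v'' t"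
    and t: "t \<in> {0..1}"
  shows "v t \<le> 0"
proof (rule ccontr)
  assume "\<not> v t \<le> 0"
  have cont: "continuous_on {0..1} v" by (rule derivative_01_at) (rule v)
  obtain m0 where m0: "m0 \<in> {0..1}" and max0: "\<And>s. s \<in> {0..1} \<Longrightarrow> v s \<le> v m0"
    using continuous_attains_sup[OF compact_Icc _ cont] by auto
  \<comment> \<open>A maximum at 1 is moved to 0, so that there is always room to the right.\<close>
  define m where "m = (if m0 = 1 then 0 else m0)"
  have m: "0 \<le> m" "m < 1" and max: "\<And>s. s \<in> {0..1} \<Longrightarrow> v s \<le> v m"
    using m0 max0 bc by (auto simp: m_def)
  have dec_right: "v' s \<le> 0" if s: "0 \<le> s" "s < 1" "v s = v m" for s
  proof (rule ccontr)
    assume "\<not> v' s \<le> 0"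
    then obtain d where "d > 0" and d: "\<And>h. h > 0 \<Longrightarrow> s + h \<in> {0..1} \<Longrightarrow> h < d \<Longrightarrow> v s < v (s + h)"
      using has_real_derivative_pos_inc_right[OF v[of s]] s by auto
    define h where "h = min (d / 2) (1 - s)"
    have "0 < h" "h < d" "h \<le> 1 - s" using \<open>d > 0\<close> s by (auto simp: h_def min_def)
    then show False
      using d[of h] max[of "s + h"] s by auto
  qed
  have inc_left: "0 \<le> v' s" if s: "0 < s" "s \<le> 1" "v s = v m" for s
  proof (rule ccontr)
    assume "\<not> 0 \<le> v' s"
    then obtain d where "d > 0" and d: "\<And>h. h > 0 \<Longrightarrow> s - h \<in> {0..1} \<Longrightarrow> h < d \<Longrightarrow> v s < v (s - h)"
      using has_real_derivative_neg_dec_left[OF v[of s]] s by auto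
    define h where "h = min (d / 2) s"
    have "0 < h" "h < d" "h \<le> s" using \<open>d > 0\<close> s by (auto simp: h_def min_def)
    then show False
      using d[of h] max[of "s - h"] s by auto
  qed
  have "v' m = 0"
  proof (cases "m = 0")
    case True
    then show ?thesis using dec_right[of 0] inc_left[of 1] bc by simp
  next
    case False
    then show ?thesis using dec_right[of m] inc_left[of m] m by simp
  qed
  moreover have "0 < v m" using max[OF t] \<open>\<not> v t \<le> 0\<close> by simp
  ultimately have "0 < v'' m" using pos[of m] m by simp
  then obtain d where "d > 0" and d: "\<And>h. h > 0 \<Longrightarrow> m + h \<in> {0..1} \<Longrightarrow> h < d \<Longrightarrow> v' m < v' (m + h)"
    using has_real_derivative_pos_inc_right[OF v'[of m]] m by auto
  define h where "h = min (d / 2) ((1 - m) / 2)"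
  have h: "0 < h" "h < d" "m + h < 1" using \<open>d > 0\<close> m by (auto simp: h_def min_def field_simps)
  have "v m < v (m + h)"
  proof (rule DERIV_pos_imp_increasing_open[where f = v])
    show "m < m + h" using h by simp
    show "\<exists>y. (v has_real_derivative y) (at x) \<and> 0 < y" if "m < x" "x < m + h" for x
      using derivative_01_at(1)[OF v, of x] d[of "x - m"] that h m \<open>v' m = 0\<close> by auto
    show "continuous_on {m..m + h} v"
      by (rule continuous_on_subset[OF cont]) (use m h in auto)
  qed
  with max[of "m + h"] m h show False by simp
qed

text \<open>Since \<open>u' = z\<close>, the factor \<open>C * z + D\<close> is the derivative of
  \<open>C * u t + D * t\<close>. Quadratic growth of \<open>z\<close> therefore costs only an
  exponential of the oscillation of \<open>u\<close>, which is at most \<open>B\<close>.\<close>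

lemma riccati_growth:
  fixes u z z' :: "real \<Rightarrow> real"
  assumes u: "\<And>t. t \<in> {0..1} \<Longrightarrow> (u has_real_derivative z t) (at t within {0..1})"
    and z: "\<And>t. t \<in> {0..1} \<Longrightarrow> (z has_real_derivative z' t) (at t within {0..1})"
    and ub: "\<And>t. t \<in> {0..1} \<Longrightarrow> 0 \<le> u t \<and> u t \<le> B"
    and C: "0 \<le> C" "0 \<le> D"
    and le: "\<And>t. t \<in> {0..1} \<Longrightarrow> 0 \<le> z t \<Longrightarrow> z' t \<le> (C * z t + D) * (1 + z t)"
    and ab: "0 \<le> a" "a \<le> b" "b \<le> 1" and m: "0 \<le> m" "z a \<le> m"
  shows "1 + z b \<le> (1 + m) * exp (C * B + D)"
proof -
  have contu: "continuous_on {0..1} u" by (rule derivative_01_at) (rule u)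
  have contz: "continuous_on {0..1} z" by (rule derivative_01_at) (rule z)
  have "continuous_on {a..b} z" by (rule continuous_on_subset[OF contz]) (use ab in auto)
  then have "closed ({a..b} \<inter> z -` {..m})" by (intro continuous_closed_preimage) auto
  then have "compact ({a..b} \<inter> ({a..b} \<inter> z -` {..m}))" by (intro compact_Int_closed) auto
  moreover have "a \<in> {a..b} \<inter> ({a..b} \<inter> z -` {..m})" using ab m by simp
  ultimately obtain s where s: "s \<in> {a..b}" "z s \<in> {..m}"
    and last: "\<And>r. r \<in> {a..b} \<Longrightarrow> z r \<in> {..m} \<Longrightarrow> r \<le> s"
    using compact_attains_sup[of "{a..b} \<inter> ({a..b} \<inter> z -` {..m})"] by blast
  define \<phi> where "\<phi> t = (1 + z t) * exp (- C * u t - D * t)" for t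
  have "\<phi> s \<ge> \<phi> b"
  proof (rule DERIV_nonpos_imp_decreasing_open[where f = \<phi>])
    show "s \<le> b" using s by simp
    fix t assume t: "s < t" "t < b"
    then have "0 < t" "t < 1" using s ab by auto
    have "\<not> z t \<le> m" using last[of t] t s by auto
    then have zt: "0 \<le> z t" using m by simp
    let ?e = "exp (- C * u t - D * t)"
    have "(\<phi> has_real_derivative z' t * ?e + (1 + z t) * (?e * (- C * z t - D))) (at t)"
      unfolding \<phi>_def
      by (auto intro!: derivative_eq_intros derivative_01_at(1)[OF u] derivative_01_at(1)[OF z] \<open>0 < t\<close> \<open>t < 1\<close>)
    moreover have "z' t * ?e + (1 + z t) * (?e * (- C * z t - D)) = (z' t - (C * z t + D) * (1 + z t)) * ?e"
      by (simp add: algebra_simps)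
    moreover have "\<dots> \<le> 0"
      using le[of t] zt \<open>0 < t\<close> \<open>t < 1\<close> by (intro mult_nonpos_nonneg) auto
    ultimately show "\<exists>y. (\<phi> has_real_derivative y) (at t) \<and> y \<le> 0" by metis
  next
    show "continuous_on {s..b} \<phi>"
      unfolding \<phi>_def
      by (intro continuous_intros continuous_on_subset[OF contu] continuous_on_subset[OF contz]) (use s ab in auto)
  qed
  then have "(1 + z b) * exp (- C * u b - D * b) * exp (C * u b + D * b)
      \<le> (1 + z s) * exp (- C * u s - D * s) * exp (C * u b + D * b)"
    by (simp add: \<phi>_def)
  then have "1 + z b \<le> (1 + z s) * exp (C * (u b - u s) + D * (b - s))"
    by (simp add: mult.assoc exp_add[symmetric] algebra_simps)
  also have "\<dots> \<le> (1 + m) * exp (C * (u b - u s) + D * (b - s))"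
    using s by (intro mult_right_mono) auto
  also have "\<dots> \<le> (1 + m) * exp (C * B + D * 1)"
  proof -
    have "u b - u s \<le> B" using ub[of b] ub[of s] s ab by auto
    then show ?thesis using m C s ab by (intro mult_left_mono) (auto intro!: add_mono mult_left_mono mult_left_le)
  qed
  finally show ?thesis by simp
qed

text \<open>The two exponential factors come from two passes: from a zero of \<open>z\<close> given
  by Rolle's theorem up to 1, then, after wrapping round by \<open>z 0 <= z 1\<close>, from 0 up to
  \<open>t\<close>.\<close>

lemma periodic_derivative_bound:
  fixes u z z' :: "real \<Rightarrow> real"
  assumes u: "\<And>t. t \<in> {0..1} \<Longrightarrow> (u has_real_derivative z t) (at t within {0..1})"
    and z: "\<And>t. t \<in> {0..1} \<Longrightarrow> (z has_real_derivative z' t) (at t within {0..1})"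
    and ub: "\<And>t. t \<in> {0..1} \<Longrightarrow> 0 \<le> u t \<and> u t \<le> B"
    and C: "0 \<le> C" "0 \<le> D"
    and le: "\<And>t. t \<in> {0..1} \<Longrightarrow> 0 \<le> z t \<Longrightarrow> z' t \<le> (C * z t + D) * (1 + z t)"
    and bc: "u 0 = u 1" "z 0 \<le> z 1"
    and t: "t \<in> {0..1}"
  shows "z t \<le> exp (C * B + D) * exp (C * B + D)"
proof -
  let ?E = "exp (C * B + D)"
  have "\<exists>s. 0 < s \<and> s < 1 \<and> z s * (1 - 0) = u 1 - u 0"
    using mvt[of 0 1 u "\<lambda>s h. z s * h"] derivative_01_at[OF u] unfolding has_field_derivative_def by (metis zero_less_one)
  then obtain s where s: "0 < s" "s < 1" "z s = 0" using bc by auto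
  have "0 \<le> B" using ub[of 0] by auto
  have "1 + z 1 \<le> (1 + 0) * ?E"
    by (rule riccati_growth[OF u z ub C le, where a = s]) (use s in auto)
  then have "z 0 \<le> ?E - 1" using bc by simp
  moreover have "1 \<le> ?E" using C \<open>0 \<le> B\<close> by simp
  ultimately have "1 + z t \<le> (1 + (?E - 1)) * ?E"
    by (intro riccati_growth[OF u z ub C le, where a = 0]) (use t in auto)
  then show ?thesis by simp
qed

section \<open>Lower and upper solutions\<close>

lemma bounded_on_compact:
  fixes F :: "'a::topological_space \<Rightarrow> real"
  assumes "compact S" "continuous_on S F"
  obtains B where "0 \<le> B" "\<And>p. p \<in> S \<Longrightarrow> \<bar>F p\<bar> \<le> B"
proof -
  have "bounded (F ` S)" by (intro compact_imp_bounded compact_continuous_image assms)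
  then show thesis using that unfolding bounded_pos by (metis imageI less_imp_le real_norm_def)
qed

lemma bounded_on_compact2:
  fixes F H :: "'a::topological_space \<Rightarrow> real"
  assumes "compact S" "continuous_on S F" "continuous_on S H"
  obtains B where "0 \<le> B" "\<And>p. p \<in> S \<Longrightarrow> \<bar>F p\<bar> + \<bar>H p\<bar> \<le> B"
proof -
  have "continuous_on S (\<lambda>p. \<bar>F p\<bar> + \<bar>H p\<bar>)" by (intro continuous_intros assms)
  from bounded_on_compact[OF assms(1) this] show thesis using that by (metis abs_le_D1)
qed

definition clamp_to :: "real \<Rightarrow> real \<Rightarrow> real \<Rightarrow> real" where
  "clamp_to a b x = max a (min b x)"

theorem theorem3p5:
  fixes f :: "real \<times> real \<times> real \<Rightarrow> real"
    and \<alpha> \<beta> :: "real \<Rightarrow> real"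
    and \<mu> l L K c0 :: real
    and c :: "real \<Rightarrow> real"
  assumes f_cont: "continuous_on ({0..1} \<times> UNIV) f"
    and lower: "lower_solution f \<alpha>"
    and upper: "upper_solution f \<beta>"
    and ordered: "\<forall>t\<in>{0..1}. \<alpha> t \<le> \<beta> t"
    and alpha_bc: "D01 \<alpha> 0 - D01 \<alpha> 1 \<ge> 0"
    and beta_bc: "D01 \<beta> 1 - D01 \<beta> 0 \<ge> 0"
    and "\<mu> > 0" and "l > 0"
    and lipschitz: "\<forall>t x1 y1 x2 y2.
      ((t, x1, y1) \<in> G \<alpha> \<mu> \<and> (t, x2, y2) \<in> G \<alpha> \<mu>) \<or>
      ((t, x1, y1) \<in> G \<beta> \<mu> \<and> (t, x2, y2) \<in> G \<beta> \<mu>) \<longrightarrow>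
      \<bar>f (t, x1, y1) - f (t, x2, y2)\<bar> \<le> l * \<bar>x1 - x2\<bar> + l * \<bar>y1 - y2\<bar>"
    and "L > 0" and "K > 0" and "c0 < 1"
    and c_cont: "continuous_on {0..1} c"
    and c_bound: "\<forall>t\<in>{0..1}. c t * (\<beta> t - \<alpha> t) \<le> c0"
    and growth_alpha: "\<forall>t\<in>{0..1}. \<forall>x z. \<alpha> t \<le> x \<and> x \<le> \<beta> t \<and> z \<ge> 0 \<longrightarrow>
      f (t, x, D01 \<alpha> t) - f (t, x, D01 \<alpha> t + z) \<le> c t * z\<^sup>2 + L * z + K"
    and growth_beta: "\<forall>t\<in>{0..1}. \<forall>x z. \<alpha> t \<le> x \<and> x \<le> \<beta> t \<and> z \<ge> 0 \<longrightarrow>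
      f (t, x, D01 \<beta> t - z) - f (t, x, D01 \<beta> t) \<le> c t * z\<^sup>2 + L * z + K"
  shows "\<exists>x. solution f x \<and> (\<forall>t\<in>{0..1}. \<alpha> t \<le> x t \<and> x t \<le> \<beta> t)"
proof -

  \<comment> \<open>Bounds on the data and choice of constants\<close>
  let ?I = "{0..1::real}"
  have low: "C2_01 \<alpha>" "\<And>t. t \<in> ?I \<Longrightarrow> - D01 (D01 \<alpha>) t \<le> f (t, \<alpha> t, D01 \<alpha> t)" "\<alpha> 0 = \<alpha> 1"
    using lower by (auto simp: lower_solution_def)
  have upp: "C2_01 \<beta>" "\<And>t. t \<in> ?I \<Longrightarrow> f (t, \<beta> t, D01 \<beta> t) \<le> - D01 (D01 \<beta>) t" "\<beta> 0 = \<beta> 1"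
    using upper by (auto simp: upper_solution_def)
  note d\<alpha> = C2_01_derivatives[OF low(1)] and d\<beta> = C2_01_derivatives[OF upp(1)]
  obtain C where C: "0 \<le> C" "\<And>t. t \<in> ?I \<Longrightarrow> \<bar>c t\<bar> \<le> C"
    using bounded_on_compact[OF compact_Icc c_cont] by blast
  obtain A0 where A0: "0 \<le> A0" "\<And>t. t \<in> ?I \<Longrightarrow> \<bar>\<alpha> t\<bar> + \<bar>\<beta> t\<bar> \<le> A0"
    by (rule bounded_on_compact2[OF compact_Icc d\<alpha>(3) d\<beta>(3)]) blast
  obtain A1 where A1: "0 \<le> A1" "\<And>t. t \<in> ?I \<Longrightarrow> \<bar>D01 \<alpha> t\<bar> + \<bar>D01 \<beta> t\<bar> \<le> A1"
    by (rule bounded_on_compact2[OF compact_Icc d\<alpha>(4) d\<beta>(4)]) blast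
  obtain A2 where A2: "0 \<le> A2" "\<And>t. t \<in> ?I \<Longrightarrow> \<bar>D01 (D01 \<alpha>) t\<bar> + \<bar>D01 (D01 \<beta>) t\<bar> \<le> A2"
    by (rule bounded_on_compact2[OF compact_Icc d\<alpha>(5) d\<beta>(5)]) blast
  have f_bounded: "\<exists>B\<ge>0. \<forall>t\<in>?I. \<forall>x y. \<bar>x\<bar> \<le> A0 \<longrightarrow> \<bar>y\<bar> \<le> A \<longrightarrow> \<bar>f (t, x, y)\<bar> \<le> B" for A
  proof -
    have "compact (?I \<times> {-A0..A0} \<times> {-A..A})" by (intro compact_Times compact_Icc)
    moreover have "continuous_on (?I \<times> {-A0..A0} \<times> {-A..A}) f"
      by (rule continuous_on_subset[OF f_cont]) auto
    ultimately obtain B where "0 \<le> B" "\<And>p. p \<in> ?I \<times> {-A0..A0} \<times> {-A..A} \<Longrightarrow> \<bar>f p\<bar> \<le> B"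
      using bounded_on_compact by blast
    then show ?thesis by (intro exI[of _ B]) (auto simp: abs_le_iff)
  qed
  obtain S where S: "0 \<le> S" "\<And>t x y. t \<in> ?I \<Longrightarrow> \<bar>x\<bar> \<le> A0 \<Longrightarrow> \<bar>y\<bar> \<le> A1 \<Longrightarrow> \<bar>f (t, x, y)\<bar> \<le> S"
    using f_bounded[of A1] by blast
  \<comment> \<open>\<open>S\<close> bounds \<open>f\<close> only at slopes up to \<open>A1\<close>,
    so neither \<open>D\<close> nor \<open>R\<close> presupposes a bound on \<open>x'\<close>.
    \<open>R\<close> adds to \<open>A1\<close> the bound of \<open>periodic_derivative_bound\<close>
    with \<open>B = A0\<close>.\<close>
  define D where "D = S + A2 + L + K"
  define R where "R = A1 + exp (C * A0 + D) * exp (C * A0 + D)"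
  have D0: "0 \<le> D" using S A2 \<open>L > 0\<close> \<open>K > 0\<close> by (simp add: D_def)
  have R: "A1 \<le> R" "0 \<le> R" using A1 by (simp_all add: R_def)

  \<comment> \<open>The truncated problem and its periodic solution\<close>
  define p q where "p t x = clamp_to (\<alpha> t) (\<beta> t) x" and "q y = clamp_to (- R) R y" for t x y
  \<comment> \<open>The equation becomes \<open>x'' = (x - p t x) - f (t, p t x, q x')\<close>: the
    bracket is the penalty, which vanishes between the lower and upper solutions.\<close>
  define g where "g = (\<lambda>(t, x, y). f (t, p t x, q y) + p t x)"
  have p_bound: "\<bar>p t x\<bar> \<le> A0" if "t \<in> ?I" for t x
    using A0(2)[OF that] ordered that by (auto simp: p_def clamp_to_def)
  have q_bound: "\<bar>q y\<bar> \<le> R" for y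
    using R by (auto simp: q_def clamp_to_def)
  have p_cont: "continuous_on (?I \<times> UNIV) (\<lambda>z :: real \<times> real \<times> real. p (fst z) (fst (snd z)))"
    unfolding p_def clamp_to_def
    by (intro continuous_intros continuous_on_compose2[OF d\<alpha>(3)] continuous_on_compose2[OF d\<beta>(3)]) auto
  have g_cont: "continuous_on (?I \<times> UNIV) g"
    unfolding g_def split_def
    by (intro continuous_on_add continuous_on_compose2[OF f_cont] continuous_on_Pair p_cont)
      (auto simp: q_def clamp_to_def intro!: continuous_intros)
  obtain B where B: "\<And>t x y. t \<in> ?I \<Longrightarrow> \<bar>x\<bar> \<le> A0 \<Longrightarrow> \<bar>y\<bar> \<le> R \<Longrightarrow> \<bar>f (t, x, y)\<bar> \<le> B"
    using f_bounded[of R] by blast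
  have "\<bar>g z\<bar> \<le> B + A0" if z_in: "z \<in> ?I \<times> UNIV" for z
  proof -
    obtain t x y where z: "z = (t, x, y)" "t \<in> ?I" using z_in by (cases z) auto
    have "\<bar>f (t, p t x, q y)\<bar> \<le> B" "\<bar>p t x\<bar> \<le> A0"
      using B p_bound q_bound z by auto
    then show ?thesis by (simp add: g_def z)
  qed
  then obtain x y where per: "x 0 = x 1" "y 0 = y 1"
    and dx: "\<And>t. t \<in> ?I \<Longrightarrow> (x has_real_derivative y t) (at t within ?I)"
    and dy: "\<And>t. t \<in> ?I \<Longrightarrow> (y has_real_derivative x t - g (t, x t, y t)) (at t within ?I)"
    using bounded_periodic_bvp[OF g_cont, of "B + A0"] by metis

  \<comment> \<open>Localization between the lower and upper solutions\<close>
  have ge: "\<alpha> t \<le> x t" if "t \<in> ?I" for t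
  proof -
    have "\<alpha> t - x t \<le> 0"
    proof (rule periodic_max_principle[where v = "\<lambda>t. \<alpha> t - x t"])
      fix t assume t: "t \<in> ?I"
      show "((\<lambda>t. \<alpha> t - x t) has_real_derivative D01 \<alpha> t - y t) (at t within ?I)"
        by (intro derivative_intros d\<alpha> dx t)
      show "((\<lambda>t. D01 \<alpha> t - y t) has_real_derivative D01 (D01 \<alpha>) t - (x t - g (t, x t, y t))) (at t within ?I)"
        by (intro derivative_intros d\<alpha> dy t)
      \<comment> \<open>Here \<open>f\<close> is evaluated exactly on the lower solution, because
        its slope is within \<open>R\<close>. The inequality for \<open>\<alpha>\<close> then leaves
        the penalty \<open>\<alpha> t - x t\<close> as a lower bound for the second derivative of
        the difference.\<close>
      assume "0 < \<alpha> t - x t" "D01 \<alpha> t - y t = 0"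
      then have "p t (x t) = \<alpha> t" "q (y t) = D01 \<alpha> t"
        using ordered t A1(2)[OF t] R by (auto simp: p_def q_def clamp_to_def)
      then show "0 < D01 (D01 \<alpha>) t - (x t - g (t, x t, y t))"
        using low(2)[OF t] \<open>0 < \<alpha> t - x t\<close> by (simp add: g_def)
    qed (use that per low alpha_bc in auto)
    then show ?thesis by simp
  qed
  have le: "x t \<le> \<beta> t" if "t \<in> ?I" for t
  proof -
    have "x t - \<beta> t \<le> 0"
    proof (rule periodic_max_principle[where v = "\<lambda>t. x t - \<beta> t"])
      fix t assume t: "t \<in> ?I"
      show "((\<lambda>t. x t - \<beta> t) has_real_derivative y t - D01 \<beta> t) (at t within ?I)"
        by (intro derivative_intros d\<beta> dx t)
      show "((\<lambda>t. y t - D01 \<beta> t) has_real_derivative (x t - g (t, x t, y t)) - D01 (D01 \<beta>) t) (at t within ?I)"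
        by (intro derivative_intros d\<beta> dy t)
      assume "0 < x t - \<beta> t" "y t - D01 \<beta> t = 0"
      then have "p t (x t) = \<beta> t" "q (y t) = D01 \<beta> t"
        using ordered t A1(2)[OF t] R by (auto simp: p_def q_def clamp_to_def)
      then show "0 < (x t - g (t, x t, y t)) - D01 (D01 \<beta>) t"
        using upp(2)[OF t] \<open>0 < x t - \<beta> t\<close> by (simp add: g_def)
    qed (use that per upp beta_bc in auto)
    then show ?thesis by simp
  qed

  \<comment> \<open>Riccati bounds on the derivative\<close>
  have p_id: "p t (x t) = x t" if "t \<in> ?I" for t
    using ge le that by (simp add: p_def clamp_to_def)
  have x'': "x t - g (t, x t, y t) = - f (t, x t, q (y t))" if "t \<in> ?I" for t
    using p_id[OF that] by (simp add: g_def)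
  \<comment> \<open>The role of \<open>z'\<close> is the excess slope after truncation, that of
    \<open>z\<close> the true one. The right side expands to
    \<open>C * z\<^sup>2 + D * z + D + C * z\<close>, whose first three terms dominate the
    quadratic, linear and constant parts.\<close>
  have growth: "c t * z'\<^sup>2 + L * z' + K + S + A2 \<le> (C * z + D) * (1 + z)"
    if "t \<in> ?I" "0 \<le> z'" "z' \<le> z" for t z z'
  proof -
    have "c t * z'\<^sup>2 \<le> C * z\<^sup>2"
      using C(2)[of t] C(1) that by (intro mult_mono power_mono) auto
    moreover have "L * z' \<le> D * z"
      using that S A2 \<open>L > 0\<close> \<open>K > 0\<close> by (intro mult_mono) (auto simp: D_def)
    moreover have "0 \<le> C * z" using C that by simp
    moreover have "K + S + A2 \<le> D" using \<open>L > 0\<close> by (simp add: D_def)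
    ultimately show ?thesis by (simp add: algebra_simps power2_eq_square)
  qed
  have x_bound: "\<bar>x t\<bar> \<le> A0" if "t \<in> ?I" for t
    using p_bound p_id that by metis
  have range: "0 \<le> x t - \<alpha> t \<and> x t - \<alpha> t \<le> A0" "0 \<le> \<beta> t - x t \<and> \<beta> t - x t \<le> A0" if "t \<in> ?I" for t
    using ge[OF that] le[OF that] A0(2)[OF that] by auto
  have y_le: "y t \<le> R" if "t \<in> ?I" for t
  proof -
    have "y t - D01 \<alpha> t \<le> exp (C * A0 + D) * exp (C * A0 + D)"
    proof (rule periodic_derivative_bound[where u = "\<lambda>t. x t - \<alpha> t" and z = "\<lambda>t. y t - D01 \<alpha> t"])
      fix t assume t: "t \<in> ?I"
      show "((\<lambda>t. x t - \<alpha> t) has_real_derivative y t - D01 \<alpha> t) (at t within ?I)"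
        by (intro derivative_intros d\<alpha> dx t)
      show "((\<lambda>t. y t - D01 \<alpha> t) has_real_derivative (x t - g (t, x t, y t)) - D01 (D01 \<alpha>) t) (at t within ?I)"
        by (intro derivative_intros d\<alpha> dy t)
      assume z: "0 \<le> y t - D01 \<alpha> t"
      \<comment> \<open>The growth condition must be applied at the slope \<open>q (y t)\<close>
        that enters the equation. As \<open>y t\<close> is above \<open>D01 \<alpha> t\<close>,
        clipping can only lower it, and not below \<open>D01 \<alpha> t\<close>; hence
        \<open>z'\<close> lies between 0 and the true excess.\<close>
      define z' where "z' = q (y t) - D01 \<alpha> t"
      have z': "0 \<le> z'" "z' \<le> y t - D01 \<alpha> t" "q (y t) = D01 \<alpha> t + z'"
        using z A1(2)[OF t] R by (auto simp: z'_def q_def clamp_to_def)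
      have "f (t, x t, D01 \<alpha> t) - f (t, x t, q (y t)) \<le> c t * z'\<^sup>2 + L * z' + K"
        using growth_alpha t ge[OF t] le[OF t] z' by simp
      moreover have "\<bar>f (t, x t, D01 \<alpha> t)\<bar> \<le> S"
        using S(2)[OF t x_bound[OF t]] A1(2)[OF t] by simp
      ultimately have "- f (t, x t, q (y t)) - D01 (D01 \<alpha>) t \<le> c t * z'\<^sup>2 + L * z' + K + S + A2"
        using A2(2)[OF t] by linarith
      with growth[OF t z'(1,2)] x''[OF t]
      show "(x t - g (t, x t, y t)) - D01 (D01 \<alpha>) t
          \<le> (C * (y t - D01 \<alpha> t) + D) * (1 + (y t - D01 \<alpha> t))" by linarith
    qed (use that range(1) C(1) D0 per low alpha_bc in auto)
    then show ?thesis using A1(2)[OF that] by (simp add: R_def)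
  qed
  have y_ge: "- R \<le> y t" if "t \<in> ?I" for t
  proof -
    \<comment> \<open>The mirror image: \<open>\<beta> - x\<close> replaces
      \<open>x - \<alpha>\<close>, and the boundary inequality for \<open>\<beta>\<close> again
      gives \<open>z 0 <= z 1\<close>.\<close>
    have "D01 \<beta> t - y t \<le> exp (C * A0 + D) * exp (C * A0 + D)"
    proof (rule periodic_derivative_bound[where u = "\<lambda>t. \<beta> t - x t" and z = "\<lambda>t. D01 \<beta> t - y t"])
      fix t assume t: "t \<in> ?I"
      show "((\<lambda>t. \<beta> t - x t) has_real_derivative D01 \<beta> t - y t) (at t within ?I)"
        by (intro derivative_intros d\<beta> dx t)
      show "((\<lambda>t. D01 \<beta> t - y t) has_real_derivative D01 (D01 \<beta>) t - (x t - g (t, x t, y t))) (at t within ?I)"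
        by (intro derivative_intros d\<beta> dy t)
      assume z: "0 \<le> D01 \<beta> t - y t"
      define z' where "z' = D01 \<beta> t - q (y t)"
      have z': "0 \<le> z'" "z' \<le> D01 \<beta> t - y t" "q (y t) = D01 \<beta> t - z'"
        using z A1(2)[OF t] R by (auto simp: z'_def q_def clamp_to_def)
      have "f (t, x t, q (y t)) - f (t, x t, D01 \<beta> t) \<le> c t * z'\<^sup>2 + L * z' + K"
        using growth_beta t ge[OF t] le[OF t] z' by simp
      moreover have "\<bar>f (t, x t, D01 \<beta> t)\<bar> \<le> S"
        using S(2)[OF t x_bound[OF t]] A1(2)[OF t] by simp
      ultimately have "D01 (D01 \<beta>) t + f (t, x t, q (y t)) \<le> c t * z'\<^sup>2 + L * z' + K + S + A2"
        using A2(2)[OF t] by linarith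
      with growth[OF t z'(1,2)] x''[OF t]
      show "D01 (D01 \<beta>) t - (x t - g (t, x t, y t))
          \<le> (C * (D01 \<beta> t - y t) + D) * (1 + (D01 \<beta> t - y t))" by linarith
    qed (use that range(2) C(1) D0 per upp beta_bc in auto)
    then show ?thesis using A1(2)[OF that] by (simp add: R_def)
  qed

  \<comment> \<open>Removal of the truncation\<close>
  have "q (y t) = y t" if "t \<in> ?I" for t
    using y_le[OF that] y_ge[OF that] by (simp add: q_def clamp_to_def)
  then have dy': "(y has_real_derivative - f (t, x t, y t)) (at t within ?I)" if "t \<in> ?I" for t
    using dy[OF that] x''[OF that] that by simp
  have "continuous_on ?I (\<lambda>t. - f (t, x t, y t))"
    by (intro continuous_on_minus continuous_on_compose2[OF f_cont] continuous_on_Pair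
        continuous_on_id derivative_01_at(2)[OF dx] derivative_01_at(2)[OF dy']) auto
  note C2 = C2_01I[OF dx dy' this]
  have "solution f x"
    unfolding solution_def using C2 per by simp
  then show ?thesis using ge le by blast
qed

end
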